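(* If there is an algorithm that solves Arc-Specified List Digraph Homomorphism in $T(n,d(I))$ steps on instances $I$ with $n=|V(G)|$, then there exists an algorithm that solves Bounded List Digraph Homomorphism in $2^{O(\ell\log h)}\cdot T(n,\ell)$ steps, where $h=|V(H)|$.
   Context: Let $G$ and $H$ be directed graphs, $G$ simple and $H$ possibly with loops but without multiple arcs; $E_1(H)$ denotes the loops and $E_2(H)$ the arcs between distinct vertices. For $\lambda:V(G)\to2^{V(H)}$, a $\lambda$-list $H$-homomorphism of $G$ is $\chi:V(G)\to V(H)$ with $\chi(v)\in\lambda(v)$ for all $v$ and $(\chi(u),\chi(v))\in E(H)$ for every arc $(u,v)$ of $G$. For $e=(a,b)\in E_2(H)$, $C(e)=\{(u,v)\in E(G)\mid \chi(u)=a,\chi(v)=b\}$. Bounded List Digraph Homomorphism: given $(G,H,\lambda,\ell)$ with $\ell\in\mathbb{Z}_{\geq0}$, output a $\lambda$-list $H$-homomorphism with $\sum_{e\in E_2(H)}|C(e)|\le\ell$ or correctly report none exists. Arc-Specified List Digraph Homomorphism: given $I=(G,H,\lambda,\alpha)$ with $\alpha:E_2(H)\to\mathbb{Z}_{\geq0}$, output a $\lambda$-list $H$-homomorphism $\chi$ with $|C(e)|=\alpha(e)$ for all $e\in E_2(H)$, or correctly report none exists; $d(I)=\sum_{e\in E_2(H)}\alpha(e)$.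
   Formalization: T is assumed nondecreasing in its last argument (needed to pass from T(n,d(I)) to T(n,ℓ)) and may also depend on h; steps are those of a fixed WHILE language on trees, and where ℓ log h < 1 the factor 2^{O(ℓ log h)} is read as a constant. *)

theory Defs
  imports Complex_Main "Graph_Theory.Pair_Digraph"
begin

section \<open>List homomorphisms of digraphs\<close>

definition list_hom ::
  "'a pair_pre_digraph \<Rightarrow> 'b pair_pre_digraph \<Rightarrow> ('a \<Rightarrow> 'b set) \<Rightarrow> ('a \<Rightarrow> 'b) \<Rightarrow> bool" where
  "list_hom G H L \<chi> \<longleftrightarrow>
     (\<forall>v \<in> pverts G. \<chi> v \<in> L v) \<and> (\<forall>(u, v) \<in> parcs G. (\<chi> u, \<chi> v) \<in> parcs H)"

definition E2 :: "'b pair_pre_digraph \<Rightarrow> ('b \<times> 'b) set" where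
  "E2 H = {(a, b) \<in> parcs H. a \<noteq> b}"

definition C :: "'a pair_pre_digraph \<Rightarrow> ('a \<Rightarrow> 'b) \<Rightarrow> 'b \<times> 'b \<Rightarrow> ('a \<times> 'a) set" where
  "C G \<chi> e = {(u, v) \<in> parcs G. \<chi> u = fst e \<and> \<chi> v = snd e}"

definition bounded_solution ::
  "'a pair_pre_digraph \<Rightarrow> 'b pair_pre_digraph \<Rightarrow> ('a \<Rightarrow> 'b set) \<Rightarrow> nat \<Rightarrow> ('a \<Rightarrow> 'b) \<Rightarrow> bool" where
  "bounded_solution G H L l \<chi> \<longleftrightarrow> list_hom G H L \<chi> \<and> (\<Sum>e \<in> E2 H. card (C G \<chi> e)) \<le> l"

definition arc_specified_solution ::
  "'a pair_pre_digraph \<Rightarrow> 'b pair_pre_digraph \<Rightarrow> ('a \<Rightarrow> 'b set) \<Rightarrow> ('b \<times> 'b \<Rightarrow> nat)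
     \<Rightarrow> ('a \<Rightarrow> 'b) \<Rightarrow> bool" where
  "arc_specified_solution G H L \<alpha> \<chi> \<longleftrightarrow>
     list_hom G H L \<chi> \<and> (\<forall>e \<in> E2 H. card (C G \<chi> e) = \<alpha> e)"

text \<open>\<open>pair_digraph\<close>: finite, without parallel arcs and loops; \<open>pair_fin_digraph\<close> admits loops.\<close>

definition hom_instance ::
  "'a pair_pre_digraph \<Rightarrow> 'b pair_pre_digraph \<Rightarrow> ('a \<Rightarrow> 'b set) \<Rightarrow> bool" where
  "hom_instance G H L \<longleftrightarrow>
     pair_digraph G \<and> pair_fin_digraph H \<and> (\<forall>v \<in> pverts G. L v \<subseteq> pverts H)"


section \<open>Algorithms and their steps\<close>

text \<open>
  Algorithms are programs of the WHILE language of N. D. Jones (Computability and Complexity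
  from a Programming Perspective): a deterministic imperative language with finitely many
  variables per program, whose values are binary trees.  Every command and every operator
  occurring in an evaluated expression is one step.  The only test available is whether a value
  is \<open>Leaf\<close>; in particular there is no unit-cost comparison of whole trees.
\<close>

datatype tree = Leaf | Node tree tree

datatype expr = Var nat | LeafE | NodeE expr expr | Left expr | Right expr

datatype com =
    Skip
  | Assign nat expr
  | Seq com com
  | If expr com com
  | While expr com

type_synonym store = "nat \<Rightarrow> tree"

primrec left :: "tree \<Rightarrow> tree" where
  "left Leaf = Leaf"
| "left (Node a b) = a"

primrec right :: "tree \<Rightarrow> tree" where
  "right Leaf = Leaf"
| "right (Node a b) = b"

primrec eval_expr :: "expr \<Rightarrow> store \<Rightarrow> tree" where
  "eval_expr (Var x) s = s x"
| "eval_expr LeafE s = Leaf"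
| "eval_expr (NodeE e f) s = Node (eval_expr e s) (eval_expr f s)"
| "eval_expr (Left e) s = left (eval_expr e s)"
| "eval_expr (Right e) s = right (eval_expr e s)"

primrec expr_steps :: "expr \<Rightarrow> nat" where
  "expr_steps (Var x) = 1"
| "expr_steps LeafE = 1"
| "expr_steps (NodeE e f) = 1 + expr_steps e + expr_steps f"
| "expr_steps (Left e) = 1 + expr_steps e"
| "expr_steps (Right e) = 1 + expr_steps e"

text \<open>\<open>exec c s t s'\<close>: started in \<open>s\<close>, the program \<open>c\<close> halts in \<open>s'\<close> after exactly \<open>t\<close> steps.\<close>

inductive exec :: "com \<Rightarrow> store \<Rightarrow> nat \<Rightarrow> store \<Rightarrow> bool" where
  Skip: "exec Skip s 1 s"
| Assign: "exec (Assign x e) s (1 + expr_steps e) (s(x := eval_expr e s))"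
| Seq: "exec c s t s' \<Longrightarrow> exec d s' t' s'' \<Longrightarrow> exec (Seq c d) s (t + t') s''"
| IfTrue: "eval_expr e s \<noteq> Leaf \<Longrightarrow> exec c s t s' \<Longrightarrow> exec (If e c d) s (1 + expr_steps e + t) s'"
| IfFalse: "eval_expr e s = Leaf \<Longrightarrow> exec d s t s' \<Longrightarrow> exec (If e c d) s (1 + expr_steps e + t) s'"
| WhileFalse: "eval_expr e s = Leaf \<Longrightarrow> exec (While e c) s (1 + expr_steps e) s"
| WhileTrue: "eval_expr e s \<noteq> Leaf \<Longrightarrow> exec c s t s' \<Longrightarrow> exec (While e c) s' t' s''
    \<Longrightarrow> exec (While e c) s (1 + expr_steps e + t + t') s''"

inductive_cases SkipE: "exec Skip s t s'"
inductive_cases AssignE: "exec (Assign x e) s t s'"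
inductive_cases SeqE: "exec (Seq c d) s t s'"
inductive_cases IfE: "exec (If e c d) s t s'"
inductive_cases WhileE: "exec (While e c) s t s'"

lemma exec_deterministic: "exec c s t s' \<Longrightarrow> exec c s u s'' \<Longrightarrow> t = u \<and> s' = s''"
proof (induction arbitrary: u s'' rule: exec.induct)
  case (Skip s)
  then show ?case by (rule SkipE) simp
next
  case (Assign x e s)
  then show ?case by (rule AssignE) simp
next
  case (Seq c s t s' d t' s2)
  from Seq.prems show ?case by (rule SeqE) (use Seq.IH in metis)
next
  case (IfTrue e s c t s' d)
  from IfTrue.prems show ?case by (rule IfE) (metis add_Suc plus_1_eq_Suc IfTrue.IH IfTrue.hyps)+
next
  case (IfFalse e s d t s' c)
  from IfFalse.prems show ?case by (rule IfE) (metis add_Suc plus_1_eq_Suc IfFalse.IH IfFalse.hyps)+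
next
  case (WhileFalse e s c)
  from WhileFalse.prems show ?case by (rule WhileE) (use WhileFalse.hyps in simp_all)
next
  case (WhileTrue e s c t s' t' s2)
  from WhileTrue.prems show ?case by (rule WhileE) (metis add_Suc plus_1_eq_Suc WhileTrue.IH WhileTrue.hyps)+
qed

definition runs :: "com \<Rightarrow> tree \<Rightarrow> tree \<Rightarrow> nat \<Rightarrow> bool" where
  "runs p x y t \<longleftrightarrow> (\<exists>s. exec p ((\<lambda>_. Leaf)(0 := x)) t s \<and> s 0 = y)"


section \<open>Inputs and outputs\<close>

text \<open>
  Numbers are unary.  The vertices of a digraph with \<open>n\<close> vertices are numbered \<open>0, \<dots>, n - 1\<close>;
  sets are given by duplicate-free lists in arbitrary order, so that an instance has several
  representations, on all of which an algorithm has to be correct.  The function \<open>\<alpha>\<close> is given by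
  the list of its nonzero values, each with its arc.
\<close>

primrec enc_list :: "tree list \<Rightarrow> tree" where
  "enc_list [] = Leaf"
| "enc_list (x # xs) = Node x (enc_list xs)"

definition enc_nat :: "nat \<Rightarrow> tree" where
  "enc_nat n = enc_list (replicate n Leaf)"

definition enc_arc :: "nat \<times> nat \<Rightarrow> tree" where
  "enc_arc e = Node (enc_nat (fst e)) (enc_nat (snd e))"

definition digraph_rep :: "nat pair_pre_digraph \<Rightarrow> tree \<Rightarrow> bool" where
  "digraph_rep D x \<longleftrightarrow>
     (\<exists>n as. pverts D = {..<n} \<and> distinct as \<and> set as = parcs D \<and>
        x = Node (enc_nat n) (enc_list (map enc_arc as)))"

definition lists_rep :: "nat \<Rightarrow> (nat \<Rightarrow> nat set) \<Rightarrow> tree \<Rightarrow> bool" where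
  "lists_rep n L x \<longleftrightarrow>
     (\<exists>ls. length ls = n \<and> (\<forall>v<n. distinct (ls ! v) \<and> set (ls ! v) = L v) \<and>
        x = enc_list (map (\<lambda>l. enc_list (map enc_nat l)) ls))"

definition spec_rep :: "nat pair_pre_digraph \<Rightarrow> (nat \<times> nat \<Rightarrow> nat) \<Rightarrow> tree \<Rightarrow> bool" where
  "spec_rep H \<alpha> x \<longleftrightarrow>
     (\<exists>es. distinct es \<and> set es = {e \<in> E2 H. \<alpha> e > 0} \<and>
        x = enc_list (map (\<lambda>e. Node (enc_arc e) (enc_nat (\<alpha> e))) es))"

definition hom_rep ::
  "nat pair_pre_digraph \<Rightarrow> nat pair_pre_digraph \<Rightarrow> (nat \<Rightarrow> nat set) \<Rightarrow> tree \<Rightarrow> tree \<Rightarrow> bool" where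
  "hom_rep G H L z x \<longleftrightarrow>
     (\<exists>g k m. digraph_rep G g \<and> digraph_rep H k \<and> lists_rep (card (pverts G)) L m \<and>
        x = Node g (Node k (Node m z)))"

text \<open>\<open>Leaf\<close> reports that there is no solution; otherwise the answer is the table of a solution.\<close>

definition correct_answer :: "nat \<Rightarrow> ((nat \<Rightarrow> nat) \<Rightarrow> bool) \<Rightarrow> tree \<Rightarrow> bool" where
  "correct_answer n sol y \<longleftrightarrow>
     (\<exists>\<chi>. sol \<chi> \<and> y = Node Leaf (enc_list (map (\<lambda>v. enc_nat (\<chi> v)) [0..<n]))) \<or>
     ((\<nexists>\<chi>. sol \<chi>) \<and> y = Leaf)"

text \<open>
  The bound takes the arguments \<open>|V(H)|\<close>, \<open>|V(G)|\<close> and \<open>d(I)\<close> or the bound \<open>l\<close>, respectively.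
  Bounds not depending on \<open>|V(H)|\<close> are a special case; but since \<open>H\<close> and the lists are part of
  the input, no program obeys such a bound.
\<close>

definition solves_arc_specified :: "com \<Rightarrow> (nat \<Rightarrow> nat \<Rightarrow> nat \<Rightarrow> real) \<Rightarrow> bool" where
  "solves_arc_specified p T \<longleftrightarrow>
     (\<forall>G H L \<alpha> z x. hom_instance G H L \<longrightarrow> spec_rep H \<alpha> z \<longrightarrow> hom_rep G H L z x \<longrightarrow>
        (\<exists>y t. runs p x y t \<and>
           correct_answer (card (pverts G)) (arc_specified_solution G H L \<alpha>) y \<and>
           real t \<le> T (card (pverts H)) (card (pverts G)) (\<Sum>e \<in> E2 H. \<alpha> e)))"

definition solves_bounded :: "com \<Rightarrow> (nat \<Rightarrow> nat \<Rightarrow> nat \<Rightarrow> real) \<Rightarrow> bool" where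
  "solves_bounded p T \<longleftrightarrow>
     (\<forall>G H L l x. hom_instance G H L \<longrightarrow> hom_rep G H L (enc_nat l) x \<longrightarrow>
        (\<exists>y t. runs p x y t \<and>
           correct_answer (card (pverts G)) (bounded_solution G H L l) y \<and>
           real t \<le> T (card (pverts H)) (card (pverts G)) l))"

end

theory Submission
  imports Defs
begin

text \<open>
  A bounded solution is an arc-specified solution for some \<open>\<alpha>\<close> of total at most \<open>l\<close>, so it suffices
  to try all such \<open>\<alpha>\<close>.  Deciding for one arc after the other whether to raise its value or to go on
  gives a binary search tree, whose \<open>(m + l choose l)\<close> leaves, for \<open>m\<close> non-loop arcs, number at most
  \<open>(m + 1) ^ l \<le> h ^ (2 * l)\<close>.  The tree is traversed with an explicit stack; the work besides
  the calls of the given program is constant per node, plus a polynomial in \<open>h\<close> for finding the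
  non-loop arcs.  For \<open>l = 0\<close> the claimed bound leaves no room for that polynomial, but then
  \<open>\<alpha> = 0\<close> is the only candidate and the arcs need not be inspected.
\<close>

section \<open>Weakest preconditions with a step counter\<close>

text \<open>The existential form includes termination and loses nothing, as execution is
  deterministic. The counter \<open>t\<close> accumulates, so a step bound is simply part of the
  postcondition.\<close>

definition wp :: "com \<Rightarrow> (store \<Rightarrow> nat \<Rightarrow> bool) \<Rightarrow> store \<Rightarrow> nat \<Rightarrow> bool" where
  "wp c Q s t \<longleftrightarrow> (\<exists>t' s'. exec c s t' s' \<and> Q s' (t + t'))"

lemma wp_Skip [simp]: "wp Skip Q s t \<longleftrightarrow> Q s (t + 1)"
proof -
  have "exec Skip s t' s' \<longleftrightarrow> t' = 1 \<and> s' = s" for t' s'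
    by (metis SkipE exec.Skip)
  then show ?thesis by (simp add: wp_def)
qed

lemma wp_Assign [simp]:
  "wp (Assign x e) Q s t \<longleftrightarrow> Q (s(x := eval_expr e s)) (t + 1 + expr_steps e)"
proof -
  have "exec (Assign x e) s t' s' \<longleftrightarrow> t' = 1 + expr_steps e \<and> s' = s(x := eval_expr e s)" for t' s'
    by (metis AssignE exec.Assign)
  then show ?thesis by (simp add: wp_def)
qed

lemma wp_Seq [simp]: "wp (Seq c d) Q s t \<longleftrightarrow> wp c (wp d Q) s t"
  unfolding wp_def add.assoc by (blast elim: SeqE intro: exec.Seq)

lemma wp_If [simp]:
  "wp (If e c d) Q s t \<longleftrightarrow>
     (if eval_expr e s \<noteq> Leaf then wp c Q s (t + 1 + expr_steps e)
      else wp d Q s (t + 1 + expr_steps e))"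
proof -
  define b where "b = (if eval_expr e s \<noteq> Leaf then c else d)"
  have "exec (If e c d) s t' s' \<longleftrightarrow> (\<exists>u. t' = 1 + expr_steps e + u \<and> exec b s u s')" for t' s'
    unfolding b_def
    by (cases "eval_expr e s = Leaf")
       (simp_all, (metis IfE exec.IfFalse plus_1_eq_Suc add_Suc, metis IfE exec.IfTrue plus_1_eq_Suc add_Suc))
  then have "wp (If e c d) Q s t \<longleftrightarrow> wp b Q s (t + 1 + expr_steps e)"
    by (simp only: wp_def add.assoc) blast
  then show ?thesis by (simp add: b_def)
qed

lemma wp_While:
  "wp (While e c) Q s t \<longleftrightarrow>
     (if eval_expr e s \<noteq> Leaf then wp c (wp (While e c) Q) s (t + 1 + expr_steps e)
      else Q s (t + 1 + expr_steps e))"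
proof (cases "eval_expr e s = Leaf")
  case True
  then show ?thesis
    unfolding wp_def by (metis WhileE exec.WhileFalse add.assoc)
next
  case False
  show ?thesis
  proof
    assume "wp (While e c) Q s t"
    then obtain t' s' where *: "exec (While e c) s t' s'" "Q s' (t + t')"
      unfolding wp_def by blast
    from *(1) obtain u s1 u' where
      "t' = 1 + expr_steps e + u + u'" "exec c s u s1" "exec (While e c) s1 u' s'"
      by (rule WhileE) (use False in auto)
    with False *(2) show "if eval_expr e s \<noteq> Leaf
      then wp c (wp (While e c) Q) s (t + 1 + expr_steps e) else Q s (t + 1 + expr_steps e)"
      unfolding wp_def by (auto simp: add.assoc)
  next
    assume "if eval_expr e s \<noteq> Leaf then wp c (wp (While e c) Q) s (t + 1 + expr_steps e)
      else Q s (t + 1 + expr_steps e)"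
    then obtain u s1 u' s' where "exec c s u s1" "exec (While e c) s1 u' s'"
      "Q s' (t + 1 + expr_steps e + u + u')"
      using False unfolding wp_def by auto
    then show "wp (While e c) Q s t"
      using exec.WhileTrue[OF False] unfolding wp_def by (metis add.assoc)
  qed
qed

text \<open>Forces the given bound \<open>T\<close> to be at least 1, so that additive overhead can
  later be absorbed into a multiple of \<open>T\<close>.\<close>

lemma exec_pos: "exec c s t s' \<Longrightarrow> t \<ge> 1"
  by (induction rule: exec.induct) auto


section \<open>Calling a program as a subroutine\<close>

primrec expr_bound :: "expr \<Rightarrow> nat" where
  "expr_bound (Var x) = Suc x"
| "expr_bound LeafE = 0"
| "expr_bound (NodeE e f) = max (expr_bound e) (expr_bound f)"
| "expr_bound (Left e) = expr_bound e"
| "expr_bound (Right e) = expr_bound e"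

primrec com_bound :: "com \<Rightarrow> nat" where
  "com_bound Skip = 0"
| "com_bound (Assign x e) = max (Suc x) (expr_bound e)"
| "com_bound (Seq c d) = max (com_bound c) (com_bound d)"
| "com_bound (If e c d) = max (expr_bound e) (max (com_bound c) (com_bound d))"
| "com_bound (While e c) = max (expr_bound e) (com_bound c)"

lemma eval_expr_cong:
  "expr_bound e \<le> k \<Longrightarrow> (\<And>x. x < k \<Longrightarrow> r x = s x) \<Longrightarrow> eval_expr e r = eval_expr e s"
  by (induction e) auto

text \<open>Control flow and assigned values depend only on variables below \<open>k\<close>, so a
  run can be replayed in any store that agrees there, with the same step count. The caller's data
  from \<open>k\<close> on survives.\<close>

lemma exec_frame:
  "exec c s t s' \<Longrightarrow> com_bound c \<le> k \<Longrightarrow> (\<And>x. x < k \<Longrightarrow> r x = s x) \<Longrightarrow>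
     \<exists>r'. exec c r t r' \<and> (\<forall>x<k. r' x = s' x) \<and> (\<forall>x\<ge>k. r' x = r x)"
proof (induction arbitrary: r rule: exec.induct)
  case (Skip s)
  then show ?case by (metis exec.Skip)
next
  case (Assign x e s)
  then have "eval_expr e r = eval_expr e s"
    by (intro eval_expr_cong[of e k]) auto
  then show ?case
    using exec.Assign[of x e r] Assign.prems by (intro exI conjI) auto
next
  case (Seq c s t s' d t' s'')
  obtain r1 where r1: "exec c r t r1" "\<forall>x<k. r1 x = s' x" "\<forall>x\<ge>k. r1 x = r x"
    using Seq.IH(1)[of r] Seq.prems by auto
  obtain r2 where r2: "exec d r1 t' r2" "\<forall>x<k. r2 x = s'' x" "\<forall>x\<ge>k. r2 x = r1 x"
    using Seq.IH(2)[of r1] Seq.prems(1) r1 by auto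
  have "exec (Seq c d) r (t + t') r2"
    using r1(1) r2(1) by (rule exec.Seq)
  with r1 r2 show ?case by auto
next
  case (IfTrue e s c t s' d)
  then have e: "eval_expr e r = eval_expr e s"
    by (intro eval_expr_cong[of e k]) auto
  obtain r1 where "exec c r t r1" "\<forall>x<k. r1 x = s' x" "\<forall>x\<ge>k. r1 x = r x"
    using IfTrue.IH[of r] IfTrue.prems by auto
  with e IfTrue.hyps(1) show ?case
    by (metis exec.IfTrue)
next
  case (IfFalse e s d t s' c)
  then have e: "eval_expr e r = eval_expr e s"
    by (intro eval_expr_cong[of e k]) auto
  obtain r1 where "exec d r t r1" "\<forall>x<k. r1 x = s' x" "\<forall>x\<ge>k. r1 x = r x"
    using IfFalse.IH[of r] IfFalse.prems by auto
  with e IfFalse.hyps(1) show ?case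
    by (metis exec.IfFalse)
next
  case (WhileFalse e s c)
  then have "eval_expr e r = eval_expr e s"
    by (intro eval_expr_cong[of e k]) auto
  with WhileFalse show ?case
    by (metis exec.WhileFalse)
next
  case (WhileTrue e s c t s' t' s'')
  then have e: "eval_expr e r = eval_expr e s"
    by (intro eval_expr_cong[of e k]) auto
  obtain r1 where r1: "exec c r t r1" "\<forall>x<k. r1 x = s' x" "\<forall>x\<ge>k. r1 x = r x"
    using WhileTrue.IH(1)[of r] WhileTrue.prems by auto
  obtain r2 where r2:
    "exec (While e c) r1 t' r2" "\<forall>x<k. r2 x = s'' x" "\<forall>x\<ge>k. r2 x = r1 x"
    using WhileTrue.IH(2)[of r1] WhileTrue.prems(1) r1 by auto
  have "exec (While e c) r (1 + expr_steps e + t + t') r2"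
    using WhileTrue.hyps(1) e r1(1) r2(1) by (intro exec.WhileTrue) auto
  with r1 r2 show ?case by auto
qed

primrec clear :: "nat \<Rightarrow> com" where
  "clear 0 = Skip"
| "clear (Suc i) = Seq (clear i) (Assign i LeafE)"

lemma wp_clear [simp]:
  "wp (clear k) Q s t \<longleftrightarrow> Q (\<lambda>x. if x < k then Leaf else s x) (t + 1 + 2 * k)"
proof (induction k arbitrary: Q)
  case (Suc k)
  have "(\<lambda>x. if x < k then Leaf else s x)(k := Leaf) = (\<lambda>x. if x < Suc k then Leaf else s x)"
    by auto
  with Suc show ?case by simp
qed simp

text \<open>\<open>runs\<close> presupposes that all variables except 0 are \<open>Leaf\<close>, so
  the remains of an earlier call are cleared first. The argument is evaluated after that and must be
  built from variables from \<open>k\<close> on.\<close>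

definition call :: "nat \<Rightarrow> com \<Rightarrow> expr \<Rightarrow> com" where
  "call k p e = Seq (clear k) (Seq (Assign 0 e) p)"

lemma wp_call:
  assumes "runs p x y u" "com_bound p \<le> k" "0 < k"
    and "eval_expr e (\<lambda>i. if i < k then Leaf else s i) = x"
    and "\<And>s'. s' 0 = y \<Longrightarrow> (\<And>i. i \<ge> k \<Longrightarrow> s' i = s i)
           \<Longrightarrow> Q s' (t + 2 + 2 * k + expr_steps e + u)"
  shows "wp (call k p e) Q s t"
proof -
  obtain s1 where s1: "exec p ((\<lambda>_. Leaf)(0 := x)) u s1" "s1 0 = y"
    using assms(1) unfolding runs_def by blast
  let ?r = "(\<lambda>i. if i < k then Leaf else s i)(0 := x)"
  obtain r' where r': "exec p ?r u r'" "\<forall>i<k. r' i = s1 i" "\<forall>i\<ge>k. r' i = ?r i"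
    using exec_frame[OF s1(1) assms(2), of ?r] by fastforce
  have "Q r' (t + 2 + 2 * k + expr_steps e + u)"
    using r' s1 assms(3) by (intro assms(5)) auto
  then show ?thesis
    unfolding call_def using r'(1) assms(4)
    by (auto simp: wp_def[of p] algebra_simps intro!: exI[of _ u] exI[of _ r'])
qed


section \<open>The non-loop arcs\<close>

lemma enc_nat_0 [simp]: "enc_nat 0 = Leaf"
  by (simp add: enc_nat_def)

lemma enc_nat_Suc [simp]: "enc_nat (Suc n) = Node Leaf (enc_nat n)"
  by (simp add: enc_nat_def)

lemma enc_nat_eq_Leaf [simp]: "enc_nat n = Leaf \<longleftrightarrow> n = 0"
  by (cases n) auto

lemma enc_list_eq_Leaf [simp]: "enc_list xs = Leaf \<longleftrightarrow> xs = []"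
  by (cases xs) auto

text \<open>
  The called program owns the variables below \<open>k\<close>.  Variable \<open>k\<close> holds the input, \<open>k + 5\<close> the stack
  and \<open>k + 6\<close> the answer; the others are scratch space, and \<open>k + 1\<close> passes the non-loop arcs to the
  search.
\<close>

definition compare_nats :: "nat \<Rightarrow> com" where
  "compare_nats k =
     While (Var (k + 3))
       (If (Var (k + 4))
         (Seq (Assign (k + 3) (Right (Var (k + 3)))) (Assign (k + 4) (Right (Var (k + 4)))))
         (Seq (Assign (k + 3) LeafE) (Assign (k + 4) (NodeE LeafE LeafE))))"

text \<open>Both numbers are decremented in parallel. If the second runs out first, variable
  \<open>k + 4\<close> is made nonempty to record the difference and the loop ends. Each round costs
  10 steps, on either branch.\<close>

lemma wp_compare_nats:
  assumes "s (k + 3) = enc_nat a" "s (k + 4) = enc_nat b"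
    and "\<And>s' t'. (s' (k + 4) = Leaf \<longleftrightarrow> a = b) \<Longrightarrow>
           (\<And>x. x \<noteq> k + 3 \<Longrightarrow> x \<noteq> k + 4 \<Longrightarrow> s' x = s x) \<Longrightarrow> t' \<le> t + 2 + 10 * a \<Longrightarrow> Q s' t'"
  shows "wp (compare_nats k) Q s t"
  using assms
proof (induction a arbitrary: b s t)
  case 0
  then show ?case
    unfolding compare_nats_def by (subst wp_While) auto
next
  case (Suc a)
  show ?case
  proof (cases b)
    case 0
    have "wp (compare_nats k) Q s' (t + 10)"
      if "s' = s(k + 3 := Leaf, k + 4 := Node Leaf Leaf)" for s'
      using that Suc.prems(3) 0 unfolding compare_nats_def by (subst wp_While) auto
    then show ?thesis
      unfolding compare_nats_def using Suc.prems(1,2) 0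
      by (subst wp_While) (simp add: numeral_eq_Suc)
  next
    case (Suc b')
    let ?s = "s(k + 3 := enc_nat a, k + 4 := enc_nat b')"
    have "wp (compare_nats k) Q ?s (t + 10)"
      by (rule Suc.IH[of _ b']) (use Suc Suc.prems(3) in auto)
    then show ?thesis
      unfolding compare_nats_def using Suc.prems(1,2) Suc
      by (subst wp_While) (simp add: numeral_eq_Suc)
  qed
qed

definition filter_arcs :: "nat \<Rightarrow> com" where
  "filter_arcs k =
     While (Var (k + 2))
       (Seq (Assign (k + 3) (Left (Left (Var (k + 2)))))
       (Seq (Assign (k + 4) (Right (Left (Var (k + 2)))))
       (Seq (compare_nats k)
       (Seq (If (Var (k + 4)) (Assign (k + 1) (NodeE (Left (Var (k + 2))) (Var (k + 1)))) Skip)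
         (Assign (k + 2) (Right (Var (k + 2))))))))"

text \<open>Kept arcs are pushed onto an accumulator, which reverses them. The comparison is linear
  in the first endpoint only, so \<open>N\<close> has to bound just that one.\<close>

lemma wp_filter_arcs:
  assumes "s (k + 2) = enc_list (map enc_arc as)" "s (k + 1) = enc_list (map enc_arc fs)"
    and "\<And>e. e \<in> set as \<Longrightarrow> fst e \<le> N"
    and "\<And>s' t'. s' (k + 1) = enc_list (map enc_arc (rev (filter (\<lambda>e. fst e \<noteq> snd e) as) @ fs)) \<Longrightarrow>
           (\<And>x. x \<notin> {k + 1..k + 4} \<Longrightarrow> s' x = s x) \<Longrightarrow>
           t' \<le> t + 2 + length as * (25 + 10 * N) \<Longrightarrow> Q s' t'"
  shows "wp (filter_arcs k) Q s t"
  using assms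
proof (induction as arbitrary: fs s t)
  case Nil
  then show ?case
    unfolding filter_arcs_def by (subst wp_While) auto
next
  case (Cons e as)
  obtain a b where e: "e = (a, b)" by force
  let ?fs = "if a = b then fs else e # fs"
  have IH: "wp (filter_arcs k) Q s' t'"
    if s': "s' (k + 2) = enc_list (map enc_arc as)" "s' (k + 1) = enc_list (map enc_arc ?fs)"
      "\<And>x. x \<notin> {k + 1..k + 4} \<Longrightarrow> s' x = s x" and t': "t' \<le> t + 25 + 10 * a" for s' t'
  proof (rule Cons.IH[OF s'(1,2)])
    show "fst e' \<le> N" if "e' \<in> set as" for e'
      using that Cons.prems(3) by simp
  next
    fix s'' t''
    assume *: "s'' (k + 1) = enc_list (map enc_arc (rev (filter (\<lambda>e. fst e \<noteq> snd e) as) @ ?fs))"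
      "\<And>x. x \<notin> {k + 1..k + 4} \<Longrightarrow> s'' x = s' x"
      "t'' \<le> t' + 2 + length as * (25 + 10 * N)"
    have "a \<le> N" using Cons.prems(3)[of e] e by simp
    with * t' have "t'' \<le> t + 2 + length (e # as) * (25 + 10 * N)" by simp
    with * s' e show "Q s'' t''"
      by (intro Cons.prems(4)) auto
  qed
  let ?s = "s(k + 3 := enc_nat a, k + 4 := enc_nat b)"
  have "wp (compare_nats k)
     (wp (Seq (If (Var (k + 4)) (Assign (k + 1) (NodeE (Left (Var (k + 2))) (Var (k + 1)))) Skip)
         (Assign (k + 2) (Right (Var (k + 2))))) (wp (filter_arcs k) Q)) ?s (t + 10)"
  proof (rule wp_compare_nats[of _ _ a b])
    fix s' t'
    assume *: "(s' (k + 4) = Leaf) = (a = b)" "\<And>x. x \<noteq> k + 3 \<Longrightarrow> x \<noteq> k + 4 \<Longrightarrow> s' x = ?s x"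
      "t' \<le> t + 10 + 2 + 10 * a"
    have s': "s' (k + 1) = enc_list (map enc_arc fs)"
      "s' (k + 2) = Node (enc_arc e) (enc_list (map enc_arc as))"
      "s' (Suc k) = enc_list (map enc_arc fs)"
      using *(2)[of "k + 1"] *(2)[of "k + 2"] Cons.prems(1,2) by auto
    show "wp (Seq (If (Var (k + 4)) (Assign (k + 1) (NodeE (Left (Var (k + 2))) (Var (k + 1)))) Skip)
         (Assign (k + 2) (Right (Var (k + 2))))) (wp (filter_arcs k) Q) s' t'"
      using * s' by (auto intro!: IH)
  qed auto
  then show ?case
    unfolding filter_arcs_def using Cons.prems(1) e
    by (subst wp_While) (simp add: enc_arc_def numeral_eq_Suc)
qed


section \<open>Enumerating the arc specifications\<close>

type_synonym spec = "((nat \<times> nat) \<times> nat) list"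

definition flush :: "(nat \<times> nat) list \<Rightarrow> spec \<Rightarrow> nat \<Rightarrow> spec" where
  "flush R z c = (if c = 0 then z else (hd R, c) # z)"

text \<open>
  A search node consists of the arcs \<open>R\<close> whose value is still open, the budget \<open>b\<close> that is left,
  the values \<open>z\<close> already fixed, and the value \<open>c\<close> given so far to the first arc of \<open>R\<close>.  Either
  that value is final, or it is increased at the cost of one unit of budget.
\<close>

fun specs :: "(nat \<times> nat) list \<Rightarrow> nat \<Rightarrow> spec \<Rightarrow> nat \<Rightarrow> spec list" where
  "specs [] b z c = [flush [] z c]"
| "specs (e # R) 0 z c = [flush (e # R) z c]"
| "specs (e # R) (Suc b) z c = specs R (Suc b) (flush (e # R) z c) 0 @ specs (e # R) b z (Suc c)"

section \<open>Size, soundness and completeness of the enumeration\<close>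

fun nodes :: "nat \<Rightarrow> nat \<Rightarrow> nat" where
  "nodes 0 b = 1"
| "nodes (Suc m) 0 = 1"
| "nodes (Suc m) (Suc b) = 1 + nodes m (Suc b) + nodes (Suc m) b"

text \<open>A binary tree with \<open>N\<close> leaves has \<open>2 * N - 1\<close> nodes, which
  explains the summand 1 and the factor 2; the number of leaves is at most
  \<open>(m + 1) ^ b\<close>.\<close>

lemma nodes_bound: "nodes m b + 1 \<le> 2 * (m + 1) ^ b"
proof (induction m b rule: nodes.induct)
  case (3 m b)
  \<comment> \<open>Bounds the leaves of the two subtrees together:
    \<open>(m + 1) * (m + 2) ^ b\<close> and \<open>(m + 2) ^ b\<close> add up to
    \<open>(m + 2) ^ Suc b\<close>.\<close>
  have "(m + 1) ^ Suc b \<le> (m + 1) * (m + 2) ^ b"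
    by (simp only: power_Suc) (intro mult_left_mono power_mono, auto)
  then have "(m + 1) ^ Suc b + (m + 2) ^ b \<le> (m + 2) ^ Suc b"
    by (simp add: algebra_simps)
  with 3 show ?case by simp
qed auto

text \<open>Raising moves one unit from \<open>b\<close> to \<open>c\<close>, and flushing moves
  \<open>c\<close> into \<open>z\<close>, so the sum on the right is invariant along every branch.
  An arc enters \<open>z\<close> only when it leaves \<open>R\<close>, which keeps the entries
  distinct.\<close>

lemma specs_sound:
  assumes "z' \<in> set (specs R b z c)" "c = 0 \<or> R \<noteq> []"
    and "distinct (R @ map fst z)" "\<forall>(e, m) \<in> set z. m > 0"
  shows "distinct (map fst z') \<and> fst ` set z' \<subseteq> set R \<union> fst ` set z \<and>
    (\<forall>(e, m) \<in> set z'. m > 0) \<and> sum_list (map snd z') \<le> sum_list (map snd z) + c + b"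
  using assms
proof (induction R b z c rule: specs.induct)
  case (3 e R b z c)
  from "3.prems"(1) consider "z' \<in> set (specs R (Suc b) (flush (e # R) z c) 0)"
    | "z' \<in> set (specs (e # R) b z (Suc c))"
    by auto
  then show ?case
  proof cases
    case 1
    let ?z = "flush (e # R) z c"
    have "distinct (R @ map fst ?z)" "\<forall>(e, m) \<in> set ?z. m > 0"
      using "3.prems"(3,4) by (auto simp: flush_def)
    moreover have "fst ` set ?z \<subseteq> insert e (fst ` set z)"
      "sum_list (map snd ?z) = sum_list (map snd z) + c"
      by (auto simp: flush_def)
    ultimately show ?thesis
      using "3.IH"(1)[OF 1 disjI1[OF refl]] by (simp add: subset_iff) blast
  next
    case 2
    from "3.IH"(2)[OF 2 _ "3.prems"(3,4)] show ?thesis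
      by simp
  qed
qed (auto simp: flush_def split: if_splits)

text \<open>A comparison of sets, because the order of the entries is irrelevant. Zero values are
  absent, in accordance with \<open>flush\<close> and \<open>spec_rep\<close>.\<close>

definition matches :: "spec \<Rightarrow> (nat \<times> nat \<Rightarrow> nat) \<Rightarrow> (nat \<times> nat) set \<Rightarrow> bool" where
  "matches z \<alpha> A \<longleftrightarrow> set z = {(e, \<alpha> e) | e. e \<in> A \<and> \<alpha> e > 0}"

lemma matches_flush:
  "matches z \<alpha> A \<Longrightarrow> \<alpha> e = c \<Longrightarrow> matches (flush (e # R) z c) \<alpha> (insert e A)"
  unfolding matches_def flush_def by auto

text \<open>The branch to follow is dictated by \<alpha>: raise while \<open>c\<close> is below the
  value of the first arc, then flush. Since \<open>c\<close> is already paid for, the open demand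
  has to be covered by \<open>b + c\<close>.\<close>

lemma specs_complete:
  assumes "matches z \<alpha> A" "c = 0 \<or> R \<noteq> []" "distinct R"
    and "R \<noteq> [] \<Longrightarrow> c \<le> \<alpha> (hd R)"
    and "sum_list (map \<alpha> R) \<le> b + c"
  shows "\<exists>z' \<in> set (specs R b z c). matches z' \<alpha> (set R \<union> A)"
  using assms
proof (induction R b z c arbitrary: A rule: specs.induct)
  case (1 b z c)
  then show ?case by (auto simp: flush_def)
next
  case (2 e R z c)
  then have "c \<le> \<alpha> e" "\<alpha> e + sum_list (map \<alpha> R) \<le> c" by simp_all
  \<comment> \<open>An exhausted budget leaves no choice: the first value is final and all later
    ones vanish, so stopping here loses nothing.\<close>
  then have "\<alpha> e = c" "sum_list (map \<alpha> R) = 0" by linarith+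
  then have "\<alpha> e = c" "\<forall>e'\<in>set R. \<alpha> e' = 0" by (simp_all add: sum_list_eq_0_iff)
  with matches_flush[OF "2.prems"(1), of e c R] show ?case
    by (auto simp: matches_def)
next
  case (3 e R b z c)
  show ?case
  proof (cases "\<alpha> e = c")
    case True
    have "\<exists>z' \<in> set (specs R (Suc b) (flush (e # R) z c) 0). matches z' \<alpha> (set R \<union> insert e A)"
      by (rule "3.IH"(1)) (use matches_flush[OF "3.prems"(1) True] "3.prems" True in auto)
    then show ?thesis by auto
  next
    case False
    have "\<exists>z' \<in> set (specs (e # R) b z (Suc c)). matches z' \<alpha> (set (e # R) \<union> A)"
      by (rule "3.IH"(2)) (use "3.prems" False in auto)
    then show ?thesis by auto
  qed
qed

section \<open>Enumerated lists as specification functions\<close>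

definition enc_spec :: "spec \<Rightarrow> tree" where
  "enc_spec z = enc_list (map (\<lambda>(e, m). Node (enc_arc e) (enc_nat m)) z)"

definition spec_fun :: "spec \<Rightarrow> nat \<times> nat \<Rightarrow> nat" where
  "spec_fun z e = (case map_of z e of None \<Rightarrow> 0 | Some m \<Rightarrow> m)"

lemma spec_fun_eq:
  "distinct (map fst z) \<Longrightarrow> (e, m) \<in> set z \<Longrightarrow> spec_fun z e = m"
  by (simp add: spec_fun_def)

lemma spec_fun_pos_iff:
  "\<forall>(e, m) \<in> set z. m > 0 \<Longrightarrow> spec_fun z e > 0 \<longleftrightarrow> e \<in> fst ` set z"
proof (cases "map_of z e")
  case None
  then have "e \<notin> fst ` set z" by (simp add: map_of_eq_None_iff)
  with None show ?thesis by (simp add: spec_fun_def)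
next
  case (Some m)
  assume "\<forall>(e, m) \<in> set z. m > 0"
  moreover from Some have "(e, m) \<in> set z" by (rule map_of_SomeD)
  ultimately have "m > 0" "e \<in> fst ` set z" by (auto intro: rev_image_eqI)
  with Some show ?thesis by (simp add: spec_fun_def)
qed

text \<open>Makes an enumerated list a legal input of the given program: by positivity its arcs are
  exactly the support of \<open>spec_fun z\<close>.\<close>

lemma spec_rep_enc_spec:
  assumes "distinct (map fst z)" "fst ` set z \<subseteq> E2 H" "\<forall>(e, m) \<in> set z. m > 0"
  shows "spec_rep H (spec_fun z) (enc_spec z)"
  unfolding spec_rep_def
proof (intro exI conjI)
  show "set (map fst z) = {e \<in> E2 H. spec_fun z e > 0}"
    using assms spec_fun_pos_iff[OF assms(3)] by auto
  show "enc_spec z = enc_list (map (\<lambda>e. Node (enc_arc e) (enc_nat (spec_fun z e))) (map fst z))"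
    using spec_fun_eq[OF assms(1)] unfolding enc_spec_def by (auto intro!: arg_cong[of _ _ enc_list])
qed (use assms in auto)

text \<open>Identifies the parameter d(I) of a call with the list total that
  \<open>specs_sound\<close> bounds.\<close>

lemma sum_spec_fun:
  assumes "distinct (map fst z)" "fst ` set z \<subseteq> A" "finite A" "\<forall>(e, m) \<in> set z. m > 0"
  shows "(\<Sum>e\<in>A. spec_fun z e) = sum_list (map snd z)"
proof -
  have "(\<Sum>e\<in>A. spec_fun z e) = (\<Sum>e\<in>fst ` set z. spec_fun z e)"
    using spec_fun_pos_iff[OF assms(4)] assms(2,3) by (intro sum.mono_neutral_right) auto
  also have "\<dots> = sum_list (map (spec_fun z) (map fst z))"
    using assms(1) by (metis list.set_map sum_list_distinct_conv_sum_set)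
  also have "map (spec_fun z) (map fst z) = map snd z"
    using spec_fun_eq[OF assms(1)] by auto
  finally show ?thesis .
qed

lemma spec_fun_matches:
  assumes "distinct (map fst z)" "matches z \<alpha> A" "e \<in> A"
  shows "spec_fun z e = \<alpha> e"
proof (cases "\<alpha> e = 0")
  case True
  with assms have "e \<notin> fst ` set z" by (auto simp: matches_def)
  with True show ?thesis by (simp add: spec_fun_def map_of_eq_None_iff[THEN iffD2])
next
  case False
  with assms have "(e, \<alpha> e) \<in> set z" unfolding matches_def by blast
  with spec_fun_eq assms(1) show ?thesis by blast
qed


section \<open>The search program\<close>

type_synonym item = "(nat \<times> nat) list \<times> nat \<times> spec \<times> nat"

fun enc_item :: "item \<Rightarrow> tree" where
  "enc_item (R, b, z, c) =
     Node (enc_list (map enc_arc R)) (Node (enc_nat b) (Node (enc_spec z) (enc_nat c)))"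

fun item_specs :: "item \<Rightarrow> spec list" where
  "item_specs (R, b, z, c) = specs R b z c"

fun item_nodes :: "item \<Rightarrow> nat" where
  "item_nodes (R, b, z, c) = nodes (length R) b"

text \<open>Rules out a pending value without an arc to carry it, for which \<open>flush\<close>
  would resort to \<open>hd []\<close>.\<close>

fun item_ok :: "item \<Rightarrow> bool" where
  "item_ok (R, b, z, c) \<longleftrightarrow> c = 0 \<or> R \<noteq> []"

definition item_expr :: "expr \<Rightarrow> expr \<Rightarrow> expr \<Rightarrow> expr \<Rightarrow> expr" where
  "item_expr R b z c = NodeE R (NodeE b (NodeE z c))"

text \<open>Emptying the stack after a positive answer serves as an early exit from the search
  loop.\<close>

definition try_spec :: "nat \<Rightarrow> com \<Rightarrow> com" where
  "try_spec k p =
     Seq (call k p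
           (NodeE (Left (Var k))
             (NodeE (Left (Right (Var k))) (NodeE (Left (Right (Right (Var k)))) (Var (k + 7))))))
       (If (Var 0) (Seq (Assign (k + 6) (Var 0)) (Assign (k + 5) LeafE)) Skip)"

text \<open>Variables \<open>k + 1\<close> to \<open>k + 4\<close> receive \<open>R\<close>,
  \<open>b\<close>, \<open>z\<close>, \<open>c\<close> of the top item, and \<open>k + 7\<close> the
  result of \<open>flush\<close>. The nested tests on \<open>R\<close> and \<open>b\<close> mirror
  the equations of \<open>specs\<close>.\<close>

definition search_body :: "nat \<Rightarrow> com \<Rightarrow> com" where
  "search_body k p =
     Seq (Assign (k + 1) (Left (Left (Var (k + 5)))))
     (Seq (Assign (k + 2) (Left (Right (Left (Var (k + 5))))))
     (Seq (Assign (k + 3) (Left (Right (Right (Left (Var (k + 5)))))))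
     (Seq (Assign (k + 4) (Right (Right (Right (Left (Var (k + 5)))))))
     (Seq (Assign (k + 5) (Right (Var (k + 5))))
     (Seq (If (Var (k + 4))
            (Assign (k + 7) (NodeE (NodeE (Left (Var (k + 1))) (Var (k + 4))) (Var (k + 3))))
            (Assign (k + 7) (Var (k + 3))))
     (If (Var (k + 1))
       (If (Var (k + 2))
         (Assign (k + 5)
           (NodeE (item_expr (Right (Var (k + 1))) (Var (k + 2)) (Var (k + 7)) LeafE)
             (NodeE (item_expr (Var (k + 1)) (Right (Var (k + 2))) (Var (k + 3))
                      (NodeE LeafE (Var (k + 4))))
               (Var (k + 5)))))
         (try_spec k p))
       (try_spec k p)))))))"

lemma wp_search_branch:
  assumes "s (k + 5) = Node (enc_item (e # R, Suc b, z, c)) S"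
    and "\<And>s' t'. s' (k + 5) = Node (enc_item (R, Suc b, flush (e # R) z c, 0))
                             (Node (enc_item (e # R, b, z, Suc c)) S) \<Longrightarrow>
           s' k = s k \<Longrightarrow> s' (k + 6) = s (k + 6) \<Longrightarrow> t' \<le> t + 80 \<Longrightarrow> Q s' t'"
  shows "wp (search_body k p) Q s t"
proof (cases "c = 0")
  case True
  then show ?thesis
    using assms(1) unfolding search_body_def item_expr_def
    by simp (rule assms(2); simp add: flush_def)
next
  case False
  then show ?thesis
    using assms(1) unfolding search_body_def item_expr_def
    by simp (rule assms(2); simp add: flush_def enc_spec_def)
qed

lemma wp_try_spec:
  assumes "com_bound p \<le> k" "0 < k"
    and "s k = Node g (Node h (Node m l))" "s (k + 7) = z"
    and "runs p (Node g (Node h (Node m z))) y u" "u \<le> \<tau>"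
    and "\<And>s' t'. s' k = s k \<Longrightarrow> s' (k + 5) = (if y = Leaf then s (k + 5) else Leaf) \<Longrightarrow>
           s' (k + 6) = (if y = Leaf then s (k + 6) else y) \<Longrightarrow> t' \<le> t + 30 + 2 * k + \<tau> \<Longrightarrow> Q s' t'"
  shows "wp (try_spec k p) Q s t"
proof -
  have "wp (call k p
           (NodeE (Left (Var k))
             (NodeE (Left (Right (Var k))) (NodeE (Left (Right (Right (Var k)))) (Var (k + 7))))))
     (wp (If (Var 0) (Seq (Assign (k + 6) (Var 0)) (Assign (k + 5) LeafE)) Skip) Q) s t"
    by (rule wp_call[OF assms(5,1,2)]) (use assms(2,3,4,6) in \<open>auto intro!: assms(7)\<close>)
  then show ?thesis unfolding try_spec_def by simp
qed

lemma wp_search_leaf: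
  assumes "com_bound p \<le> k" "0 < k"
    and "s k = Node g (Node h (Node m l))"
    and "s (k + 5) = Node (enc_item (R, b, z, c)) S"
    and "R = [] \<or> b = 0" "c = 0 \<or> R \<noteq> []"
    and "runs p (Node g (Node h (Node m (enc_spec (flush R z c))))) y u" "u \<le> \<tau>"
    and "\<And>s' t'. s' k = s k \<Longrightarrow> s' (k + 5) = (if y = Leaf then S else Leaf) \<Longrightarrow>
           s' (k + 6) = (if y = Leaf then s (k + 6) else y) \<Longrightarrow> t' \<le> t + 80 + 2 * k + \<tau> \<Longrightarrow> Q s' t'"
  shows "wp (search_body k p) Q s t"
proof -
  \<comment> \<open>The bound 80 is split into 50 steps for unpacking the item and 30 for the call
    and the handling of its answer.\<close>
  have *: "wp (try_spec k p) Q s' t'"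
    if "s' k = s k" "s' (k + 5) = S" "s' (k + 6) = s (k + 6)"
      "s' (k + 7) = enc_spec (flush R z c)" "t' \<le> t + 50" for s' t'
  proof (rule wp_try_spec[where s = s', OF assms(1,2) _ that(4) assms(7,8)])
    show "s' k = Node g (Node h (Node m l))"
      using that(1) assms(3) by simp
    show "Q s'' t''" if "s'' k = s' k" "s'' (k + 5) = (if y = Leaf then s' (k + 5) else Leaf)"
      "s'' (k + 6) = (if y = Leaf then s' (k + 6) else y)" "t'' \<le> t' + 30 + 2 * k + \<tau>" for s'' t''
    proof (rule assms(9))
      show "t'' \<le> t + 80 + 2 * k + \<tau>"
        using that(4) \<open>t' \<le> t + 50\<close> by linarith
    qed (use that(1-3) \<open>s' k = s k\<close> \<open>s' (k + 5) = S\<close> \<open>s' (k + 6) = s (k + 6)\<close> in simp_all)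
  qed
  consider "R = []" "c = 0" | e R' where "R = e # R'" "c = 0" "b = 0"
    | e R' where "R = e # R'" "c \<noteq> 0" "b = 0"
    using assms(5,6) by (metis neq_Nil_conv)
  then show ?thesis
  proof cases
    case 1
    then show ?thesis
      using assms(4) unfolding search_body_def by simp (rule *; simp add: flush_def)
  next
    case 2
    then show ?thesis
      using assms(4) unfolding search_body_def by simp (rule *; simp add: flush_def)
  next
    case 3
    then show ?thesis
      using assms(4) unfolding search_body_def
      by simp (rule *; simp add: flush_def enc_spec_def)
  qed
qed

section \<open>The search loop and the complete program\<close>

definition search :: "nat \<Rightarrow> com \<Rightarrow> com" where
  "search k p = While (Var (k + 5)) (search_body k p)"

text \<open>The number of nodes still to be visited: it is both the termination measure of the loop
  and the factor in its step bound.\<close>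

definition total :: "item list \<Rightarrow> nat" where
  "total its = sum_list (map item_nodes its)"

definition all_specs :: "item list \<Rightarrow> spec set" where
  "all_specs its = (\<Union>it \<in> set its. set (item_specs it))"

lemma all_specs_Cons [simp]: "all_specs (it # its) = set (item_specs it) \<union> all_specs its"
  by (simp add: all_specs_def)

lemma total_Cons [simp]: "total (it # its) = item_nodes it + total its"
  by (simp add: total_def)

text \<open>Every iteration removes one node of the forest on the stack, at a cost of 80 steps plus
  2 for the loop test, besides clearing and the call. The answer stays \<open>Leaf\<close> as long
  as every call has failed; \<open>ok\<close> abstracts from what a correct answer is.\<close>

lemma wp_search:
  assumes "com_bound p \<le> k" "0 < k"
    and "s k = Node g (Node h (Node m l))" "s (k + 6) = Leaf"
    and "s (k + 5) = enc_list (map enc_item its)" "\<forall>it \<in> set its. item_ok it"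
    and "\<And>z. z \<in> all_specs its \<Longrightarrow>
           \<exists>y u. runs p (Node g (Node h (Node m (enc_spec z)))) y u \<and> u \<le> \<tau> \<and> ok z y"
    and "\<And>s' t'. t' \<le> t + 2 + total its * (82 + 2 * k + \<tau>) \<Longrightarrow>
           s' (k + 6) \<noteq> Leaf \<and> (\<exists>z \<in> all_specs its. ok z (s' (k + 6))) \<or>
           s' (k + 6) = Leaf \<and> (\<forall>z \<in> all_specs its. ok z Leaf) \<Longrightarrow> Q s' t'"
  shows "wp (search k p) Q s t"
  using assms(3-)
proof (induction "total its" arbitrary: its s t rule: less_induct)
  case less
  show ?case
  proof (cases its)
    case Nil
    then show ?thesis
      using less.prems unfolding search_def by (subst wp_While) (auto simp: all_specs_def)
  next
    case (Cons it its')
    obtain R b z c where it: "it = (R, b, z, c)" by (cases it)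
    let ?K = "82 + 2 * k + \<tau>"
    have "wp (search_body k p) (wp (search k p) Q) s (t + 2)"
    proof (cases "R = [] \<or> b = 0")
      case True
      then have specs: "specs R b z c = [flush R z c]" and nodes: "nodes (length R) b = 1"
        by (cases R; cases b; simp)+
      obtain y u where y: "runs p (Node g (Node h (Node m (enc_spec (flush R z c))))) y u"
        "u \<le> \<tau>" "ok (flush R z c) y"
        using less.prems(5)[of "flush R z c"] Cons it specs by auto
      show ?thesis
      proof (rule wp_search_leaf[where s = s, OF assms(1,2) less.prems(1) _ True _ y(1,2)])
        show "s (k + 5) = Node (enc_item (R, b, z, c)) (enc_list (map enc_item its'))"
          using less.prems(3) Cons it by simp
        show "c = 0 \<or> R \<noteq> []" using less.prems(4) Cons it by simp
        fix s' t'
        assume s': "s' k = s k" "s' (k + 5) = (if y = Leaf then enc_list (map enc_item its') else Leaf)"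
          "s' (k + 6) = (if y = Leaf then s (k + 6) else y)" and t': "t' \<le> t + 2 + 80 + 2 * k + \<tau>"
        show "wp (search k p) Q s' t'"
        proof (cases "y = Leaf")
          case y_Leaf: True
          show ?thesis
          proof (rule less.hyps[of its'])
            show "total its' < total its" using Cons it nodes by simp
            show "\<exists>y u. runs p (Node g (Node h (Node m (enc_spec z)))) y u \<and> u \<le> \<tau> \<and> ok z y"
              if "z \<in> all_specs its'" for z
              using that less.prems(5) Cons by simp
            show "Q s'' t''"
              if "t'' \<le> t' + 2 + total its' * ?K"
                "s'' (k + 6) \<noteq> Leaf \<and> (\<exists>z \<in> all_specs its'. ok z (s'' (k + 6))) \<or>
                 s'' (k + 6) = Leaf \<and> (\<forall>z \<in> all_specs its'. ok z Leaf)" for s'' t''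
              by (rule less.prems(6)) (use that t' Cons it specs nodes y y_Leaf in auto)
          qed (use s' y_Leaf less.prems Cons in auto)
        next
          case False
          \<comment> \<open>The success has emptied the stack, so only the final loop test
            remains.\<close>
          have "Q s' (t' + 2)"
            by (rule less.prems(6)) (use False s' t' y Cons it specs nodes in auto)
          with False s' show ?thesis
            unfolding search_def by (subst wp_While) simp
        qed
      qed
    next
      case False
      then obtain e R' b' where R: "R = e # R'" "b = Suc b'"
        by (cases R; cases b) auto
      let ?its = "(R', Suc b', flush (e # R') z c, 0) # (e # R', b', z, Suc c) # its'"
      have specs: "all_specs its = all_specs ?its" and total: "total its = Suc (total ?its)"
        using Cons it R by auto
      show ?thesis
      proof (rule wp_search_branch)
        show "s (k + 5) = Node (enc_item (e # R', Suc b', z, c)) (enc_list (map enc_item its'))"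
          using less.prems(3) Cons it R by simp
        fix s' t'
        assume s': "s' (k + 5) = Node (enc_item (R', Suc b', flush (e # R') z c, 0))
                     (Node (enc_item (e # R', b', z, Suc c)) (enc_list (map enc_item its')))"
          "s' k = s k" "s' (k + 6) = s (k + 6)" and t': "t' \<le> t + 2 + 80"
        show "wp (search k p) Q s' t'"
        proof (rule less.hyps[of ?its])
          show "total ?its < total its" using total by simp
          show "\<exists>y u. runs p (Node g (Node h (Node m (enc_spec z)))) y u \<and> u \<le> \<tau> \<and> ok z y"
            if "z \<in> all_specs ?its" for z
            using that less.prems(5) specs by blast
          show "Q s'' t''"
            if "t'' \<le> t' + 2 + total ?its * ?K"
              "s'' (k + 6) \<noteq> Leaf \<and> (\<exists>z \<in> all_specs ?its. ok z (s'' (k + 6))) \<or>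
               s'' (k + 6) = Leaf \<and> (\<forall>z \<in> all_specs ?its. ok z Leaf)" for s'' t''
          proof (rule less.prems(6))
            show "t'' \<le> t + 2 + total its * ?K"
              using that(1) t' unfolding total by simp
          qed (use that(2) specs in simp)
        qed (use s' less.prems Cons in auto)
      qed
    qed
    then show ?thesis
      using less.prems(3) Cons it unfolding search_def by (subst wp_While) simp
  qed
qed

text \<open>The input is saved because calls overwrite variable 0. For budget 0, variable
  \<open>k + 1\<close> keeps its initial \<open>Leaf\<close>, which encodes the empty list of
  arcs.\<close>

definition bounded_prog :: "nat \<Rightarrow> com \<Rightarrow> com" where
  "bounded_prog k p =
     Seq (Assign k (Var 0))
     (Seq (If (Right (Right (Right (Var k))))
            (Seq (Assign (k + 2) (Right (Left (Right (Var k))))) (filter_arcs k))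
            Skip)
     (Seq (Assign (k + 5)
            (NodeE (item_expr (Var (k + 1)) (Right (Right (Right (Var k)))) LeafE LeafE) LeafE))
     (Seq (search k p)
       (Assign 0 (Var (k + 6))))))"

lemma runs_bounded_prog:
  assumes "com_bound p \<le> k" "0 < k" "\<forall>e \<in> set as. fst e \<le> N"
    and fs: "fs = (if l = 0 then [] else rev (filter (\<lambda>e. fst e \<noteq> snd e) as))"
    and h: "h = Node hn (enc_list (map enc_arc as))"
    and sub: "\<forall>z \<in> set (specs fs l [] 0).
           \<exists>y u. runs p (Node g (Node h (Node m (enc_spec z)))) y u \<and> u \<le> \<tau> \<and> ok z y"
  shows "\<exists>y t. runs (bounded_prog k p) (Node g (Node h (Node m (enc_nat l)))) y t \<and>
    t \<le> 50 + (if l = 0 then 0 else length as * (25 + 10 * N)) + nodes (length fs) l * (82 + 2 * k + \<tau>) \<and>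
    (y \<noteq> Leaf \<and> (\<exists>z \<in> set (specs fs l [] 0). ok z y) \<or>
     y = Leaf \<and> (\<forall>z \<in> set (specs fs l [] 0). ok z Leaf))"
proof -
  let ?x = "Node g (Node h (Node m (enc_nat l)))"
  let ?F = "if l = 0 then 0 else length as * (25 + 10 * N)"
  define Q where "Q = (\<lambda>s t. t \<le> 50 + ?F + nodes (length fs) l * (82 + 2 * k + \<tau>) \<and>
    (s 0 \<noteq> Leaf \<and> (\<exists>z \<in> set (specs fs l [] 0). ok z (s (0::nat))) \<or>
     s 0 = Leaf \<and> (\<forall>z \<in> set (specs fs l [] 0). ok z Leaf)))"
  \<comment> \<open>The condition at the point where both branches of the initial test meet, so that
    the search is analysed only once.\<close>
  define Q1 where "Q1 = wp (Seq (Assign (k + 5)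
            (NodeE (item_expr (Var (k + 1)) (Right (Right (Right (Var k)))) LeafE LeafE) LeafE))
     (Seq (search k p) (Assign 0 (Var (k + 6))))) Q"
  have Q1: "Q1 s t"
    if "s k = ?x" "s (k + 1) = enc_list (map enc_arc fs)" "s (k + 6) = Leaf" "t \<le> 25 + ?F" for s t
  proof -
    let ?s = "s(k + 5 := enc_list (map enc_item [(fs, l, [], 0)]))"
    \<comment> \<open>The 13 steps are the cost of placing the root item on the stack.\<close>
    have "wp (search k p) (wp (Assign 0 (Var (k + 6))) Q) ?s (t + 13)"
    proof (rule wp_search[where its = "[(fs, l, [], 0)]" and s = ?s and ok = ok, OF assms(1,2)])
      show "?s k = ?x" using that by simp
      show "\<exists>y u. runs p (Node g (Node h (Node m (enc_spec z)))) y u \<and> u \<le> \<tau> \<and> ok z y"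
        if "z \<in> all_specs [(fs, l, [], 0)]" for z
        using that sub by (simp add: all_specs_def)
      show "wp (Assign 0 (Var (k + 6))) Q s' t'"
        if "t' \<le> t + 13 + 2 + total [(fs, l, [], 0)] * (82 + 2 * k + \<tau>)"
          "s' (k + 6) \<noteq> Leaf \<and> (\<exists>z \<in> all_specs [(fs, l, [], 0)]. ok z (s' (k + 6))) \<or>
           s' (k + 6) = Leaf \<and> (\<forall>z \<in> all_specs [(fs, l, [], 0)]. ok z Leaf)" for s' t'
        using that \<open>t \<le> 25 + ?F\<close> unfolding Q_def wp_Assign
        by (simp add: total_def all_specs_def)
    qed (use that in simp_all)
    then show ?thesis
      unfolding Q1_def using that by (simp add: item_expr_def enc_spec_def numeral_eq_Suc)
  qed
  have "wp (If (Right (Right (Right (Var k))))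
            (Seq (Assign (k + 2) (Right (Left (Right (Var k))))) (filter_arcs k)) Skip)
     Q1 ((\<lambda>_. Leaf)(0 := ?x, k := ?x)) 2"
  proof (cases "l = 0")
    case True
    then show ?thesis
      using assms(2) fs by (simp, intro Q1) auto
  next
    case False
    let ?s = "(\<lambda>_. Leaf)(0 := ?x, k := ?x, k + 2 := enc_list (map enc_arc as))"
    have "wp (filter_arcs k) Q1 ?s 12"
    proof (rule wp_filter_arcs[where s = ?s and fs = "[]" and as = as and N = N])
      show "Q1 s' t'"
        if "s' (k + 1) = enc_list (map enc_arc (rev (filter (\<lambda>e. fst e \<noteq> snd e) as) @ []))"
          "\<And>x. x \<notin> {k + 1..k + 4} \<Longrightarrow> s' x = ?s x" "t' \<le> 12 + 2 + length as * (25 + 10 * N)" for s' t'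
        by (rule Q1) (use that assms(2) False fs in auto)
    qed (use assms(2,3) in auto)
    with False show ?thesis using assms(2) h by (simp add: numeral_eq_Suc)
  qed
  then have "wp (bounded_prog k p) Q ((\<lambda>_. Leaf)(0 := ?x)) 0"
    unfolding bounded_prog_def Q1_def by (simp add: numeral_eq_Suc)
  then obtain t s where "exec (bounded_prog k p) ((\<lambda>_. Leaf)(0 := ?x)) t s" "Q s t"
    unfolding wp_def by auto
  then show ?thesis
    unfolding runs_def Q_def by blast
qed


section \<open>Correctness and running time\<close>

lemma ex_spec:
  assumes "distinct fs" "l \<noteq> 0 \<Longrightarrow> set fs = E" "l = 0 \<Longrightarrow> fs = []" "finite E"
    and "(\<Sum>e\<in>E. \<alpha> e) \<le> l"
  shows "\<exists>z \<in> set (specs fs l [] 0). \<forall>e\<in>E. spec_fun z e = \<alpha> e"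
proof (cases "l = 0")
  case True
  \<comment> \<open>A total of 0 makes \<alpha> vanish on \<open>E\<close>, and the empty list
    represents exactly that.\<close>
  with assms show ?thesis by (auto simp: flush_def spec_fun_def)
next
  case False
  have "sum_list (map \<alpha> fs) \<le> l"
    using assms False by (metis sum_list_distinct_conv_sum_set)
  then obtain z where z: "z \<in> set (specs fs l [] 0)" "matches z \<alpha> (set fs)"
    using specs_complete[of "[]" \<alpha> "{}" 0 fs l] assms(1) by (auto simp: matches_def)
  then have "distinct (map fst z)"
    using specs_sound[OF z(1)] assms(1) by simp
  with z False assms(2) show ?thesis
    using spec_fun_matches by blast
qed

lemma correct_answer_bounded:
  assumes "distinct fs" "l \<noteq> 0 \<Longrightarrow> set fs = E2 H" "l = 0 \<Longrightarrow> fs = []" "finite (E2 H)"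
    and "y \<noteq> Leaf \<and>
       (\<exists>z \<in> set (specs fs l [] 0). correct_answer n (arc_specified_solution G H L (spec_fun z)) y) \<or>
     y = Leaf \<and>
       (\<forall>z \<in> set (specs fs l [] 0). correct_answer n (arc_specified_solution G H L (spec_fun z)) Leaf)"
  shows "correct_answer n (bounded_solution G H L l) y"
  using assms(5)
proof (elim disjE conjE bexE)
  fix z
  assume y: "y \<noteq> Leaf" "correct_answer n (arc_specified_solution G H L (spec_fun z)) y"
    and z: "z \<in> set (specs fs l [] 0)"
  have *: "distinct (map fst z)" "fst ` set z \<subseteq> set fs" "\<forall>(e, m) \<in> set z. m > 0"
    "sum_list (map snd z) \<le> l"
    using specs_sound[OF z] assms(1) by auto
  have "fst ` set z \<subseteq> E2 H"
    using *(2) assms(2,3) by (cases "l = 0") auto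
  with * have sum: "(\<Sum>e\<in>E2 H. spec_fun z e) \<le> l"
    using sum_spec_fun assms(4) by metis
  have "bounded_solution G H L l \<chi>" if "arc_specified_solution G H L (spec_fun z) \<chi>" for \<chi>
    using that sum unfolding bounded_solution_def arc_specified_solution_def by simp
  with y show ?thesis
    unfolding correct_answer_def by blast
next
  assume y: "y = Leaf"
    "\<forall>z \<in> set (specs fs l [] 0). correct_answer n (arc_specified_solution G H L (spec_fun z)) Leaf"
  have "\<not> bounded_solution G H L l \<chi>" for \<chi>
  proof
    assume sol: "bounded_solution G H L l \<chi>"
    \<comment> \<open>The arc counts of a bounded solution have total at most \<open>l\<close>, so
      they occur among the candidates.\<close>
    then obtain z where z: "z \<in> set (specs fs l [] 0)" "\<forall>e\<in>E2 H. spec_fun z e = card (C G \<chi> e)"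
      using ex_spec[OF assms(1-4), where \<alpha> = "\<lambda>e. card (C G \<chi> e)"]
      unfolding bounded_solution_def by blast
    with sol have "arc_specified_solution G H L (spec_fun z) \<chi>"
      unfolding bounded_solution_def arc_specified_solution_def by simp
    with y z(1) show False
      unfolding correct_answer_def by auto
  qed
  with y(1) show ?thesis
    unfolding correct_answer_def by blast
qed

section \<open>Arithmetic of the step bound\<close>

lemma steps_bound:
  fixes a f h k l \<tau> :: nat
  assumes "a \<le> (max 1 h)\<^sup>2" "f + 1 \<le> (max 1 h)\<^sup>2"
  shows "50 + (if l = 0 then 0 else a * (25 + 10 * h)) + nodes f l * (82 + 2 * k + \<tau>)
     \<le> (85 + 2 * (82 + 2 * k + \<tau>)) * max 1 h ^ (3 * l)"
proof -
  let ?H = "max 1 h"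
  have H: "1 \<le> ?H ^ n" for n by simp
  have "(if l = 0 then 0 else a * (25 + 10 * h)) \<le> 35 * ?H ^ (3 * l)"
  proof (cases "l = 0")
    case False
    \<comment> \<open>Filtering is cubic in the number of vertices, which \<open>3 * l\<close> in
      the exponent covers once \<open>l\<close> is positive.\<close>
    have "a * (25 + 10 * h) \<le> ?H\<^sup>2 * (35 * ?H)"
      using assms(1) by (intro mult_mono) auto
    also have "\<dots> = 35 * ?H ^ 3" by (simp add: power2_eq_square power3_eq_cube)
    also have "\<dots> \<le> 35 * ?H ^ (3 * l)"
      using False by (intro mult_left_mono power_increasing) auto
    finally show ?thesis using False by simp
  qed simp
  moreover have "nodes f l * (82 + 2 * k + \<tau>) \<le> (2 * ?H ^ (3 * l)) * (82 + 2 * k + \<tau>)"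
  proof (rule mult_right_mono)
    have "nodes f l \<le> 2 * (f + 1) ^ l" using nodes_bound[of f l] by simp
    also have "(f + 1) ^ l \<le> (?H\<^sup>2) ^ l" using assms(2) by (intro power_mono) auto
    also have "\<dots> = ?H ^ (2 * l)" by (simp add: power_mult)
    also have "\<dots> \<le> ?H ^ (3 * l)" by (intro power_increasing) auto
    finally show "nodes f l \<le> 2 * ?H ^ (3 * l)" by simp
  qed simp
  moreover have "50 \<le> 50 * ?H ^ (3 * l)" using H by simp
  ultimately have "50 + (if l = 0 then 0 else a * (25 + 10 * h)) + nodes f l * (82 + 2 * k + \<tau>)
      \<le> 50 * ?H ^ (3 * l) + 35 * ?H ^ (3 * l) + (2 * ?H ^ (3 * l)) * (82 + 2 * k + \<tau>)"
    by (intro add_mono)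
  also have "\<dots> = (85 + 2 * (82 + 2 * k + \<tau>)) * ?H ^ (3 * l)"
    by (simp add: algebra_simps)
  finally show ?thesis .
qed

text \<open>The constant factor becomes a summand \<open>log 2 D\<close> of the exponent. The
  maximum with 1 leaves room for it when \<open>l = 0\<close> or \<open>h \<le> 1\<close>.\<close>

lemma power_le_powr:
  fixes D :: real and h l :: nat
  assumes "D \<ge> 1"
  shows "D * real (max 1 h ^ (3 * l)) \<le> 2 powr ((log 2 D + 3) * max 1 (real l * log 2 (real h)))"
proof -
  let ?m = "real l * log 2 (real h)"
  have "real (max 1 h ^ (3 * l)) = 2 powr (3 * ?m)"
  proof (cases "h = 0")
    case True
    \<comment> \<open>Here \<open>log 2 0\<close> is 0, so both sides equal 1.\<close>
    then show ?thesis by (simp add: log_def)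
  next
    case False
    have "2 powr (3 * ?m) = (2 powr log 2 (real h)) powr real (3 * l)"
      by (simp add: powr_powr mult_ac)
    also have "\<dots> = real h ^ (3 * l)"
      using False by (subst powr_realpow) auto
    finally show ?thesis using False by (simp add: max_def)
  qed
  moreover have "D = 2 powr log 2 D" using assms by simp
  ultimately have "D * real (max 1 h ^ (3 * l)) = 2 powr (log 2 D + 3 * ?m)"
    by (metis powr_add)
  also have "\<dots> \<le> 2 powr ((log 2 D + 3) * max 1 ?m)"
  proof (rule powr_mono)
    have "log 2 D * 1 \<le> log 2 D * max 1 ?m"
      using assms by (intro mult_left_mono) auto
    moreover have "3 * ?m \<le> 3 * max 1 ?m" by simp
    ultimately show "log 2 D + 3 * ?m \<le> (log 2 D + 3) * max 1 ?m"
      by (simp add: distrib_right)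
  qed simp
  finally show ?thesis .
qed

text \<open>Candidates may have total below \<open>l\<close>; monotonicity of \<open>T\<close> in
  its last argument bounds their calls by the value at \<open>l\<close>. The constant
  \<open>c\<close> depends on the given program only.\<close>

theorem theorem5:
  fixes T :: "nat \<Rightarrow> nat \<Rightarrow> nat \<Rightarrow> real"
  assumes "\<And>h n. mono (T h n)"
    and "\<exists>A. solves_arc_specified A T"
  shows "\<exists>B c. solves_bounded B
           (\<lambda>h n l. 2 powr (c * max 1 (real l * log 2 (real h))) * T h n l)"
proof -
  obtain p where p: "solves_arc_specified p T" using assms(2) by blast
  \<comment> \<open>The successor ensures that variable 0, used for input and output, lies in the
    area of the called program.\<close>
  define k where "k = Suc (com_bound p)"
  have k: "com_bound p \<le> k" "0 < k" by (simp_all add: k_def)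
  \<comment> \<open>The factor from \<open>steps_bound\<close> with 1 in place of \<tau>; as
    \<open>T\<close> is at least 1, multiplying by \<open>T\<close> covers every summand.\<close>
  define D where "D = 85 + 2 * (82 + 2 * real k + 1)"
  have "\<exists>y t. runs (bounded_prog k p) x y t \<and>
       correct_answer (card (pverts G)) (bounded_solution G H L l) y \<and>
       real t \<le> 2 powr ((log 2 D + 3) * max 1 (real l * log 2 (real (card (pverts H))))) *
         T (card (pverts H)) (card (pverts G)) l"
    if inst: "hom_instance G H L" and rep: "hom_rep G H L (enc_nat l) x" for G H L l x
  proof -
    let ?n = "card (pverts G)" and ?h = "card (pverts H)"
    obtain g hh m where x: "digraph_rep G g" "digraph_rep H hh" "lists_rep ?n L m"
      "x = Node g (Node hh (Node m (enc_nat l)))"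
      using rep unfolding hom_rep_def by blast
    obtain h as where as: "pverts H = {..<h}" "distinct as" "set as = parcs H"
      "hh = Node (enc_nat h) (enc_list (map enc_arc as))"
      using x(2) unfolding digraph_rep_def by blast
    have h: "?h = h" using as(1) by simp
    interpret H: pair_fin_digraph H using inst by (simp add: hom_instance_def)
    have arcs: "parcs H \<subseteq> {..<h} \<times> {..<h}"
      using H.arc_fst_in_verts H.arc_snd_in_verts as(1) by fastforce
    define fs where "fs = (if l = 0 then [] else rev (filter (\<lambda>e. fst e \<noteq> snd e) as))"
    have fs: "distinct fs" "l \<noteq> 0 \<Longrightarrow> set fs = E2 H" "l = 0 \<Longrightarrow> fs = []"
      using as(2,3) by (auto simp: fs_def E2_def)
    have fin: "finite (E2 H)"
      by (rule finite_subset[OF _ H.pair_finite_arcs]) (auto simp: E2_def)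
    let ?ok = "\<lambda>z. correct_answer ?n (arc_specified_solution G H L (spec_fun z))"
    let ?T = "T h ?n l"
    have sub: "\<exists>y u. runs p (Node g (Node hh (Node m (enc_spec z)))) y u \<and>
        u \<le> nat \<lfloor>?T\<rfloor> \<and> ?ok z y \<and> 1 \<le> ?T" if z: "z \<in> set (specs fs l [] 0)" for z
    proof -
      have *: "distinct (map fst z)" "fst ` set z \<subseteq> set fs" "\<forall>(e, m) \<in> set z. m > 0"
        "sum_list (map snd z) \<le> l"
        using specs_sound[OF z] fs(1) by auto
      have E2: "fst ` set z \<subseteq> E2 H"
        using *(2) fs(2,3) by (cases "l = 0") auto
      have "spec_rep H (spec_fun z) (enc_spec z)"
        using spec_rep_enc_spec[OF *(1) E2 *(3)] .
      moreover have "hom_rep G H L (enc_spec z) (Node g (Node hh (Node m (enc_spec z))))"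
        using x(1-3) unfolding hom_rep_def by blast
      ultimately obtain y u where y: "runs p (Node g (Node hh (Node m (enc_spec z)))) y u"
        "?ok z y" "real u \<le> T ?h ?n (\<Sum>e\<in>E2 H. spec_fun z e)"
        using p inst unfolding solves_arc_specified_def by blast
      have "(\<Sum>e\<in>E2 H. spec_fun z e) \<le> l"
        using sum_spec_fun[OF *(1) E2 fin *(3)] *(4) by simp
      then have u: "real u \<le> ?T"
        using y(3) monoD[OF assms(1)] h by (metis order_trans)
      moreover have "1 \<le> u"
        using y(1) exec_pos unfolding runs_def by blast
      ultimately have "1 \<le> ?T" "u \<le> nat \<lfloor>?T\<rfloor>" by linarith+
      with y show ?thesis by blast
    qed
    have N: "\<forall>e \<in> set as. fst e \<le> h"
      using as(3) arcs by auto
    have "\<forall>z \<in> set (specs fs l [] 0).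
        \<exists>y u. runs p (Node g (Node hh (Node m (enc_spec z)))) y u \<and> u \<le> nat \<lfloor>?T\<rfloor> \<and> ?ok z y"
      using sub by blast
    from runs_bounded_prog[OF k N fs_def as(4) this]
    obtain y t where t: "runs (bounded_prog k p) x y t"
      "t \<le> 50 + (if l = 0 then 0 else length as * (25 + 10 * h)) +
        nodes (length fs) l * (82 + 2 * k + nat \<lfloor>?T\<rfloor>)"
      and y: "y \<noteq> Leaf \<and> (\<exists>z \<in> set (specs fs l [] 0). ?ok z y) \<or>
        y = Leaf \<and> (\<forall>z \<in> set (specs fs l [] 0). ?ok z Leaf)"
      unfolding x(4) by (elim exE conjE) simp
    have "length as \<le> (max 1 h)\<^sup>2"
    proof -
      have "length as = card (parcs H)" using as(2,3) distinct_card by metis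
      also have "\<dots> \<le> card ({..<h} \<times> {..<h})" using arcs by (intro card_mono) auto
      also have "\<dots> \<le> (max 1 h)\<^sup>2" by (auto simp: power2_eq_square intro: mult_mono)
      finally show ?thesis .
    qed
    moreover have "length fs + 1 \<le> (max 1 h)\<^sup>2"
    proof (cases "l = 0 \<or> h = 0")
      case True
      then have "fs = []" using fs arcs by (cases "l = 0") (auto simp: E2_def)
      then show ?thesis by simp
    next
      case False
      have "length fs = card (E2 H)" using fs False distinct_card by metis
      \<comment> \<open>Leaving out the pair \<open>(0, 0)\<close>, which is never a non-loop arc,
        gains the 1 needed for the base \<open>m + 1\<close> of the node bound.\<close>
      also have "\<dots> \<le> card ({..<h} \<times> {..<h} - {(0, 0)})"
        using arcs by (intro card_mono) (auto simp: E2_def)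
      also have "\<dots> = h * h - 1" using False by (subst card_Diff_singleton) auto
      finally have "length fs \<le> h * h - 1" .
      moreover have "0 < h * h" using False by simp
      ultimately have "length fs + 1 \<le> h * h" by linarith
      then show ?thesis using False by (simp add: power2_eq_square max_def)
    qed
    ultimately have t': "t \<le> (85 + 2 * (82 + 2 * k + nat \<lfloor>?T\<rfloor>)) * max 1 h ^ (3 * l)"
      using steps_bound t(2) order_trans by blast
    \<comment> \<open>The zero specification is always a candidate, so at least one call is
      available to show that \<open>T\<close> is at least 1.\<close>
    obtain z where "z \<in> set (specs fs l [] 0)"
      using ex_spec[OF fs fin, where \<alpha> = "\<lambda>_. 0"] by auto
    then have T1: "1 \<le> ?T" using sub by blast
    have "real t \<le> (85 + 2 * (82 + 2 * real k + real (nat \<lfloor>?T\<rfloor>))) * real (max 1 h ^ (3 * l))"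
      using of_nat_mono[OF t', where 'a = real] by simp
    also have "\<dots> \<le> (D * ?T) * real (max 1 h ^ (3 * l))"
    proof (rule mult_right_mono)
      have "real (nat \<lfloor>?T\<rfloor>) \<le> ?T" using T1 by linarith
      moreover have "249 + 4 * real k \<le> (249 + 4 * real k) * ?T"
        using T1 by (simp add: mult_le_cancel_left1)
      ultimately show "85 + 2 * (82 + 2 * real k + real (nat \<lfloor>?T\<rfloor>)) \<le> D * ?T"
        unfolding D_def by (simp add: algebra_simps)
    qed simp
    also have "\<dots> = (D * real (max 1 h ^ (3 * l))) * ?T" by simp
    also have "\<dots> \<le> 2 powr ((log 2 D + 3) * max 1 (real l * log 2 (real h))) * ?T"
      using T1 by (intro mult_right_mono power_le_powr) (auto simp: D_def)
    finally show ?thesis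
      using t(1) correct_answer_bounded[OF fs fin y] h by blast
  qed
  then show ?thesis
    unfolding solves_bounded_def by blast
qed

end
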